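(* Let $k$ be an integer and let $G$ be a graph with $m(G)\le k$. Then there exists a forest $F\subseteq G$ such that $m_2(G\setminus F)\le k$, where $G\setminus F$ is obtained from $G$ by deleting the edges of $F$ (but no vertices).
   Context: For a graph $J$, $v_J,e_J$ are its numbers of vertices and edges; $m(G)=\max\{e_J/v_J: J\subseteq G, v_J\ge1\}$. For a graph $H$: $m_2(H)=\max\{(e_J-1)/(v_J-2): J\subseteq H, v_J\ge 3\}$ if $H$ has an edge and $v_H\ge3$; $m_2(K_2)=1/2$; $m_2(H)=0$ if $H$ has no edges. *)

theory Defs
  imports Complex_Main
begin

record 'a sgraph =
  verts :: "'a set"
  edges :: "'a set set"

definition graph :: "'a sgraph \<Rightarrow> bool" where
  "graph G \<longleftrightarrow> finite (verts G) \<and> (\<forall>e \<in> edges G. e \<subseteq> verts G \<and> card e = 2)"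

definition subgraph :: "'a sgraph \<Rightarrow> 'a sgraph \<Rightarrow> bool" where
  "subgraph J G \<longleftrightarrow> graph J \<and> verts J \<subseteq> verts G \<and> edges J \<subseteq> edges G"

abbreviation num_verts :: "'a sgraph \<Rightarrow> nat" where "num_verts J \<equiv> card (verts J)"

abbreviation num_edges :: "'a sgraph \<Rightarrow> nat" where "num_edges J \<equiv> card (edges J)"

text \<open>The maximum is over the empty set exactly when \<open>G\<close> has no vertices; the density of
  the null graph is then 0 by convention.\<close>

definition max_density :: "'a sgraph \<Rightarrow> real" where
  "max_density G = (if verts G = {} then 0
     else Max {real (num_edges J) / real (num_verts J) | J. subgraph J G \<and> num_verts J \<ge> 1})"

text \<open>The last branch is the case of \<open>K\<^sub>2\<close>: it is the only graph with an edge
  and fewer than three vertices. The numerator is a difference of reals, so edgeless subgraphs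
  contribute negative values to the maximum.\<close>

definition max_2density :: "'a sgraph \<Rightarrow> real" where
  "max_2density H = (if edges H = {} then 0
     else if num_verts H \<ge> 3
       then Max {(real (num_edges J) - 1) / (real (num_verts J) - 2) | J. subgraph J H \<and> num_verts J \<ge> 3}
     else 1 / 2)"

definition cycle_in :: "'a sgraph \<Rightarrow> 'a list \<Rightarrow> bool" where
  "cycle_in G c \<longleftrightarrow> length c \<ge> 3 \<and> distinct c \<and>
     (\<forall>i < length c. {c ! i, c ! (Suc i mod length c)} \<in> edges G)"

definition forest :: "'a sgraph \<Rightarrow> bool" where
  "forest F \<longleftrightarrow> graph F \<and> (\<nexists>c. cycle_in F c)"

definition delete_edges :: "'a sgraph \<Rightarrow> 'a sgraph \<Rightarrow> 'a sgraph" where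
  "delete_edges G F = \<lparr>verts = verts G, edges = edges G - edges F\<rparr>"

end

theory Submission
  imports Defs
begin

text \<open>By Hall's theorem, \<open>m(G) \<le> k\<close> lets us orient the edges of \<open>G\<close> with all outdegrees at most
  \<open>k\<close>. Let \<open>R\<close> be a smallest set of vertices that can be reached from every vertex; no vertex can then
  be reached from two elements of \<open>R\<close>. The forest \<open>F\<close> consists of the first edge of a shortest
  directed path to \<open>R\<close>, for each vertex outside \<open>R\<close>. In \<open>H = G \ F\<close> consider a set \<open>S\<close> of
  vertices, where each \<open>v \<in> S\<close> misses \<open>k\<close> minus its outdegree in \<open>H[S]\<close>. Every \<open>v \<in> S - R\<close> misses
  at least 1, and every \<open>r \<in> S \<inter> R\<close> misses at least \<open>k\<close> minus the number of its
  out-neighbours in \<open>S\<close>, which are outside \<open>R\<close>. If \<open>|S \<inter> R| \<ge> 2\<close>, two such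
  out-neighbourhoods are disjoint, so that the total is at least \<open>2k\<close>; otherwise it is at least
  \<open>|S| - 1\<close>. Hence \<open>H[S]\<close> has at most \<open>k(|S| - 2) + 1\<close> edges if \<open>|S| \<ge> 2k\<close>. For \<open>3 \<le> |S| < 2k\<close>
  any graph on \<open>S\<close> satisfies this bound.\<close>

section \<open>Hall's theorem and orientations of bounded outdegree\<close>

theorem hall_marriage:
  fixes A :: "'i \<Rightarrow> 'b set"
  assumes "finite I" and "\<And>i. i \<in> I \<Longrightarrow> finite (A i)"
    and "\<And>J. J \<subseteq> I \<Longrightarrow> card J \<le> card (\<Union>(A ` J))"
  shows "\<exists>f. inj_on f I \<and> (\<forall>i\<in>I. f i \<in> A i)"
  using assms
proof (induction "card I" arbitrary: I A rule: less_induct)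
  case less
  note fin = less.prems(1,2) and hall = less.prems(3)
  show ?case
  \<comment> \<open>Either some nonempty proper subfamily has no element to spare, and it and the
    rest are matched separately, or all of them have one to spare, and one index can be given an
    arbitrary element of its set.\<close>
  proof (cases "\<exists>J. J \<noteq> {} \<and> J \<subset> I \<and> card (\<Union>(A ` J)) = card J")
    case True
    then obtain J where J: "J \<noteq> {}" "J \<subset> I" and tight: "card (\<Union>(A ` J)) = card J"
      by blast
    have finJ: "finite J"
      using J fin(1) finite_subset by auto
    define B where "B i = A i - \<Union>(A ` J)" for i
    have "card J < card I"
      using J(2) fin(1) psubset_card_mono by blast
    then obtain f where f: "inj_on f J" "\<forall>i\<in>J. f i \<in> A i"
      using less.hyps[of J A] J(2) finJ fin(2) hall by (meson order_trans psubsetD psubset_imp_subset)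
    have "card (I - J) < card I"
      using J fin(1) by (intro psubset_card_mono) auto
    moreover have "card K \<le> card (\<Union>(B ` K))" if K: "K \<subseteq> I - J" for K
    proof -
      \<comment> \<open>Tightness of \<open>J\<close> lets its share cancel from Hall's condition
        for \<open>K \<union> J\<close>.\<close>
      have "card K + card J = card (K \<union> J)"
        using K finJ fin(1) by (subst card_Un_disjoint) (auto intro: finite_subset)
      also have "\<dots> \<le> card (\<Union>(A ` (K \<union> J)))"
        using K J by (intro hall) auto
      also have "\<Union>(A ` (K \<union> J)) = \<Union>(B ` K) \<union> \<Union>(A ` J)"
        by (auto simp: B_def)
      also have "card \<dots> \<le> card (\<Union>(B ` K)) + card J"
        using tight card_Un_le by metis
      finally show ?thesis by simp
    qed
    ultimately obtain g where g: "inj_on g (I - J)" "\<forall>i\<in>I - J. g i \<in> B i"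
      using less.hyps[of "I - J" B] fin by (auto simp: B_def)
    define h where "h i = (if i \<in> J then f i else g i)" for i
    have "h i \<noteq> h j" if "i \<in> J" "j \<in> I - J" for i j
      using that f(2) g(2) by (auto simp: h_def B_def)
    then have "inj_on h I"
      using f(1) g(1) unfolding inj_on_def h_def by (metis DiffI)
    moreover have "\<forall>i\<in>I. h i \<in> A i"
      using f(2) g(2) by (auto simp: h_def B_def)
    ultimately show ?thesis by blast
  next
    case no_tight: False
    show ?thesis
    proof (cases "I = {}")
      case True
      then show ?thesis by simp
    next
      case False
      then obtain i where i: "i \<in> I" by blast
      have "card {i} \<le> card (\<Union>(A ` {i}))"
        using i by (intro hall) auto
      then obtain x where x: "x \<in> A i"
        by fastforce
      have "card (I - {i}) < card I"
        using i fin(1) by (meson card_Diff1_less)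
      moreover have "card K \<le> card (\<Union>((\<lambda>j. A j - {x}) ` K))" if K: "K \<subseteq> I - {i}" for K
      proof (cases "K = {}")
        case False
        have "K \<subset> I" using K i by auto
        then have "card K < card (\<Union>(A ` K))"
          using False no_tight hall[of K] by (metis le_neq_implies_less psubset_imp_subset)
        moreover have "\<Union>((\<lambda>j. A j - {x}) ` K) = \<Union>(A ` K) - {x}"
          by auto
        ultimately show ?thesis
          using card_Diff_singleton_if[of "\<Union>(A ` K)" x] by (auto split: if_splits)
      qed simp
      ultimately obtain f where f: "inj_on f (I - {i})" "\<forall>j\<in>I - {i}. f j \<in> A j - {x}"
        using less.hyps[of "I - {i}" "\<lambda>j. A j - {x}"] fin by auto
      then have "inj_on (f(i := x)) I"
        by (auto simp: inj_on_def)
      moreover have "\<forall>j\<in>I. (f(i := x)) j \<in> A j"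
        using f(2) x by auto
      ultimately show ?thesis by blast
    qed
  qed
qed

text \<open>Hall's theorem matches each edge to one of \<open>k\<close> copies of one of its ends.
  That end, \<open>t e\<close>, serves as the tail of \<open>e\<close>, so no vertex is a tail more
  than \<open>k\<close> times.\<close>

lemma ex_bounded_outdegree_orientation:
  fixes E :: "'a set set"
  assumes "finite E" and "\<And>e. e \<in> E \<Longrightarrow> finite e"
    and "\<And>A. A \<subseteq> E \<Longrightarrow> card A \<le> k * card (\<Union>A)"
  shows "\<exists>t. (\<forall>e\<in>E. t e \<in> e) \<and> (\<forall>v. card {e \<in> E. t e = v} \<le> k)"
proof -
  have "card J \<le> card (\<Union>((\<lambda>e. e \<times> {..<k}) ` J))" if "J \<subseteq> E" for J
  proof -
    have "\<Union>((\<lambda>e. e \<times> {..<k}) ` J) = \<Union>J \<times> {..<k}"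
      by auto
    then show ?thesis
      using assms(3)[OF that] by (simp add: card_cartesian_product mult.commute)
  qed
  then obtain f where f: "inj_on f E" "\<forall>e\<in>E. f e \<in> e \<times> {..<k}"
    using hall_marriage[of E "\<lambda>e. e \<times> {..<k}"] assms(1,2) by auto
  have "card {e \<in> E. fst (f e) = v} \<le> k" for v
  proof -
    have "f ` {e \<in> E. fst (f e) = v} \<subseteq> {v} \<times> {..<k}"
      using f(2) by force
    moreover have "inj_on f {e \<in> E. fst (f e) = v}"
      using f(1) by (auto intro: inj_on_subset)
    ultimately have "card {e \<in> E. fst (f e) = v} \<le> card ({v} \<times> {..<k})"
      by (intro card_inj_on_le[of f]) auto
    then show ?thesis by simp
  qed
  moreover have "\<forall>e\<in>E. fst (f e) \<in> e"
    using f(2) by force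
  ultimately show ?thesis
    by (intro exI[of _ "\<lambda>e. fst (f e)"]) simp
qed

section \<open>Roots, parents and acyclicity\<close>

text \<open>In a smallest set that every vertex reaches, no root reaches another, or it could be
  dropped. Two roots that reach a common \<open>v\<close> also reach any root that \<open>v\<close>
  reaches, so both are equal to it.\<close>

lemma ex_separated_roots:
  assumes "finite V"
  obtains R where "R \<subseteq> V" "\<And>v. v \<in> V \<Longrightarrow> \<exists>r\<in>R. (v, r) \<in> D\<^sup>*"
    "\<And>r r' v. \<lbrakk>r \<in> R; r' \<in> R; v \<in> V; (r, v) \<in> D\<^sup>*; (r', v) \<in> D\<^sup>*\<rbrakk> \<Longrightarrow> r = r'"
proof -
  define P where "P R \<longleftrightarrow> R \<subseteq> V \<and> (\<forall>v\<in>V. \<exists>r\<in>R. (v, r) \<in> D\<^sup>*)" for R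
  have "P V" unfolding P_def by blast
  then obtain R where R: "P R" and R_min: "\<And>R'. P R' \<Longrightarrow> card R \<le> card R'"
    by (metis ex_has_least_nat)
  have irredundant: False if "r \<in> R" "q \<in> R" "r \<noteq> q" "(r, q) \<in> D\<^sup>*" for r q
  proof -
    have "P (R - {r})"
      using R that unfolding P_def by (metis Diff_iff empty_iff insert_iff rtrancl_trans subset_iff)
    moreover have "card (R - {r}) < card R"
      using R that(1) assms by (meson P_def card_Diff1_less finite_subset)
    ultimately show False
      using R_min by fastforce
  qed
  have "r = r'" if rs: "r \<in> R" "r' \<in> R" and v: "v \<in> V" "(r, v) \<in> D\<^sup>*" "(r', v) \<in> D\<^sup>*" for r r' v
  proof -
    obtain q where "q \<in> R" "(v, q) \<in> D\<^sup>*"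
      using R v(1) by (auto simp: P_def)
    then show ?thesis
      using irredundant rs v by (metis rtrancl_trans)
  qed
  with that R show thesis
    by (auto simp: P_def)
qed

text \<open>Here \<open>d\<close> is the distance to \<open>R\<close>, and \<open>p v\<close> is the
  next vertex on a shortest path. The decrease of \<open>d\<close> is what later excludes
  cycles.\<close>

lemma ex_parent_towards:
  assumes "\<And>v. v \<in> V \<Longrightarrow> \<exists>r\<in>R. (v, r) \<in> D\<^sup>*" and "D \<subseteq> V \<times> V"
  obtains p and d :: "'a \<Rightarrow> nat" where "\<And>v. v \<in> V - R \<Longrightarrow> (v, p v) \<in> D \<and> d (p v) < d v"
proof -
  define P where "P v n \<longleftrightarrow> (\<exists>r\<in>R. (v, r) \<in> D ^^ n)" for v n
  define d where "d v = (LEAST n. P v n)" for v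
  have "\<exists>w. (v, w) \<in> D \<and> d w < d v" if v: "v \<in> V - R" for v
  proof -
    have "\<exists>n. P v n"
      using assms(1) v unfolding P_def by (meson DiffD1 rtrancl_imp_relpow)
    then have "P v (d v)"
      unfolding d_def by (rule LeastI_ex)
    then obtain r where r: "r \<in> R" "(v, r) \<in> D ^^ d v"
      by (auto simp: P_def)
    then obtain m where m: "d v = Suc m"
      using v by (cases "d v") auto
    then obtain w where w: "(v, w) \<in> D" "(w, r) \<in> D ^^ m"
      using r(2) by (metis relpow_Suc_D2)
    then have "d w \<le> m"
      using r(1) unfolding d_def P_def by (intro Least_le) auto
    then show ?thesis
      using w m by auto
  qed
  then show thesis
    using that[of "\<lambda>v. SOME w. (v, w) \<in> D \<and> d w < d v" d] by (metis (mono_tags, lifting) someI_ex)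
qed

text \<open>At a vertex of the cycle with the largest \<open>d\<close>, both incident cycle edges
  must lead to its parent, but its two neighbours on a cycle of length at least 3 are
  distinct.\<close>

lemma no_cycle_in_parent_graph:
  fixes d :: "'a \<Rightarrow> nat"
  assumes "\<And>e. e \<in> edges F \<Longrightarrow> \<exists>v. e = {v, p v} \<and> d (p v) < d v"
  shows "\<not> cycle_in F c"
proof
  assume c: "cycle_in F c"
  define n where "n = length c"
  have n: "n \<ge> 3" and dist: "distinct c"
    and cyc: "\<And>i. i < n \<Longrightarrow> {c ! i, c ! (Suc i mod n)} \<in> edges F"
    using c by (auto simp: cycle_in_def n_def)
  have "\<exists>i<n. \<forall>j<n. d (c ! j) \<le> d (c ! i)"
  proof -
    define M where "M = Max ((\<lambda>i. d (c ! i)) ` {..<n})"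
    have "M \<in> (\<lambda>i. d (c ! i)) ` {..<n}"
      unfolding M_def using n by (intro Max_in) (auto simp: lessThan_empty_iff)
    moreover have "\<forall>j<n. d (c ! j) \<le> M"
      unfolding M_def by auto
    ultimately show ?thesis by auto
  qed
  then obtain i where i: "i < n" and top: "\<And>j. j < n \<Longrightarrow> d (c ! j) \<le> d (c ! i)"
    by blast
  define a where "a = Suc i mod n"
  define b where "b = (if i = 0 then n - 1 else i - 1)"
  have a: "a < n" and b: "b < n" and ib: "Suc b mod n = i"
    using i n by (auto simp: a_def b_def)
  have "a \<noteq> b"
    using i n by (auto simp: a_def b_def mod_Suc split: if_splits)
  have nbr: "c ! j = p (c ! i)" if e: "{c ! i, c ! j} \<in> edges F" and "j < n" for j
  proof -
    obtain v where "{c ! i, c ! j} = {v, p v}" "d (p v) < d v"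
      using assms e by blast
    then show ?thesis
      using top[OF \<open>j < n\<close>] by (auto simp: doubleton_eq_iff)
  qed
  have "c ! a = p (c ! i)"
    using nbr[OF _ a] cyc[OF i] by (simp add: a_def)
  moreover have "c ! b = p (c ! i)"
    using nbr[OF _ b] cyc[OF b] ib by (simp add: insert_commute)
  ultimately show False
    using \<open>a \<noteq> b\<close> a b dist by (metis n_def nth_eq_iff_index_eq)
qed

section \<open>Counting the edges that remain\<close>

text \<open>The counting argument freed from graphs: \<open>o' v\<close> stands for the outdegree of
  \<open>v\<close> inside \<open>S\<close> after the deletion, \<open>N r\<close> for the
  out-neighbours of a root \<open>r\<close> in the full orientation.\<close>

lemma rooted_outdegree_sum_le:
  fixes N :: "'a \<Rightarrow> 'a set" and o' :: "'a \<Rightarrow> nat"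
  assumes S: "finite S" "2 * k \<le> card S" "1 \<le> k"
    and le_k: "\<And>v. v \<in> S \<Longrightarrow> o' v \<le> k"
    and nonroot: "\<And>v. v \<in> S - R \<Longrightarrow> o' v < k"
    and root: "\<And>r. r \<in> S \<inter> R \<Longrightarrow> o' r \<le> card (N r \<inter> S)"
    and N_R: "\<And>r. r \<in> R \<Longrightarrow> N r \<inter> R = {}"
    and disj: "\<And>r r'. \<lbrakk>r \<in> R; r' \<in> R; r \<noteq> r'\<rbrakk> \<Longrightarrow> N r \<inter> N r' = {}"
  shows "(\<Sum>v\<in>S. o' v) + 2 * k \<le> k * card S + 1"
proof -
  define m where "m v = k - o' v" for v
  have "(\<Sum>v\<in>S. o' v) + (\<Sum>v\<in>S. m v) = (\<Sum>v\<in>S. k)"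
    unfolding sum.distrib[symmetric] using le_k by (intro sum.cong) (auto simp: m_def)
  then have total: "(\<Sum>v\<in>S. o' v) + (\<Sum>v\<in>S. m v) = k * card S"
    by simp
  have split: "(\<Sum>v\<in>S. m v) = (\<Sum>v\<in>S - R. m v) + (\<Sum>v\<in>S \<inter> R. m v)"
    using S(1) by (subst sum.Int_Diff[of S _ R]) auto
  have "(\<Sum>v\<in>S - R. 1) \<le> (\<Sum>v\<in>S - R. m v)"
    using nonroot by (intro sum_mono) (force simp: m_def)
  then have nonroots: "card (S - R) \<le> (\<Sum>v\<in>S - R. m v)"
    by simp
  \<comment> \<open>The slack of 1 is for the first case, where a single root in \<open>S\<close>
    may miss nothing.\<close>
  have "2 * k \<le> (\<Sum>v\<in>S. m v) + 1"
  proof (cases "card (S \<inter> R) \<le> 1")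
    case True
    have "card S = card (S - R) + card (S \<inter> R)"
      using S(1) by (metis add.commute card_Int_Diff)
    then show ?thesis
      using S True split nonroots by linarith
  next
    case False
    then obtain r r' where r: "r \<in> S \<inter> R" "r' \<in> S \<inter> R" "r \<noteq> r'"
      using S(1) by (metis One_nat_def card_le_Suc0_iff_eq finite_Int)
    \<comment> \<open>What \<open>m r + m r'\<close> lacks to \<open>2 * k\<close> is at most the
      size of these two disjoint sets of nonroots, and each nonroot in \<open>S\<close> contributes
      at least 1.\<close>
    have "card (N r \<inter> S) + card (N r' \<inter> S) = card ((N r \<inter> S) \<union> (N r' \<inter> S))"
      using S(1) disj r by (intro card_Un_disjoint[symmetric]) auto
    also have "\<dots> \<le> card (S - R)"
      using S(1) N_R r by (intro card_mono) auto
    finally have "card (N r \<inter> S) + card (N r' \<inter> S) \<le> card (S - R)" .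
    moreover have "(\<Sum>v\<in>{r, r'}. m v) \<le> (\<Sum>v\<in>S \<inter> R. m v)"
      using S(1) r by (intro sum_mono2) auto
    moreover have "k \<le> m r + card (N r \<inter> S)" "k \<le> m r' + card (N r' \<inter> S)"
      using root[OF r(1)] root[OF r(2)] by (auto simp: m_def)
    ultimately show ?thesis
      using split nonroots r(3) by simp
  qed
  with total show ?thesis by linarith
qed

lemma card_2_subsets_le:
  assumes "finite S" "\<And>e. e \<in> E \<Longrightarrow> e \<subseteq> S \<and> card e = 2"
  shows "2 * card E \<le> card S * (card S - 1)"
proof -
  have "card E \<le> card {e. e \<subseteq> S \<and> card e = 2}"
    using assms by (intro card_mono) auto
  also have "\<dots> = card S choose 2"
    using assms(1) by (rule n_subsets)
  finally show ?thesis
    by (simp add: choose_two)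
qed

text \<open>The last bound is (e_J - 1)/(v_J - 2) \<le> k with denominators and subtractions
  cleared, so that it can be proved in the naturals.\<close>

lemma ex_forest_sparse_remainder:
  assumes G: "graph G" and k: "1 \<le> k"
    and sparse: "\<And>A. A \<subseteq> edges G \<Longrightarrow> card A \<le> k * card (\<Union>A)"
  obtains F where "forest F" "subgraph F G"
    "\<And>J. \<lbrakk>subgraph J (delete_edges G F); 3 \<le> num_verts J\<rbrakk>
       \<Longrightarrow> num_edges J + 2 * k \<le> k * num_verts J + 1"
proof -
  define V E where "V = verts G" and "E = edges G"
  have finV: "finite V" and E: "\<And>e. e \<in> E \<Longrightarrow> e \<subseteq> V \<and> card e = 2"
    using G by (auto simp: graph_def V_def E_def)
  have finE: "finite E"
    using finV E by (intro finite_subset[of E "Pow V"]) auto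
  obtain t where t: "\<And>e. e \<in> E \<Longrightarrow> t e \<in> e" and out_le: "\<And>v. card {e \<in> E. t e = v} \<le> k"
    using ex_bounded_outdegree_orientation[of E k] finE E finV sparse
    by (metis E_def finite_subset)
  define D where "D = {(u, w). {u, w} \<in> E \<and> t {u, w} = u}"
  have D_V: "D \<subseteq> V \<times> V"
    using E by (auto simp: D_def)
  obtain R where R: "R \<subseteq> V" "\<And>v. v \<in> V \<Longrightarrow> \<exists>r\<in>R. (v, r) \<in> D\<^sup>*"
    and sep: "\<And>r r' v. \<lbrakk>r \<in> R; r' \<in> R; v \<in> V; (r, v) \<in> D\<^sup>*; (r', v) \<in> D\<^sup>*\<rbrakk> \<Longrightarrow> r = r'"
    using ex_separated_roots[OF finV, of D] by metis
  obtain p and d :: "'a \<Rightarrow> nat"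
    where p: "\<And>v. v \<in> V - R \<Longrightarrow> (v, p v) \<in> D \<and> d (p v) < d v"
    using ex_parent_towards[OF R(2) D_V] by metis
  define F where "F = \<lparr>verts = V, edges = (\<lambda>v. {v, p v}) ` (V - R)\<rparr>"
  have F_E: "edges F \<subseteq> E"
    using p by (auto simp: F_def D_def)
  have graphF: "graph F"
    using finV E F_E by (auto simp: graph_def F_def)
  have "forest F"
    unfolding forest_def using graphF no_cycle_in_parent_graph[of F p d] p by (auto simp: F_def)
  moreover have "subgraph F G"
    using graphF F_E by (simp add: subgraph_def F_def V_def E_def)
  moreover have "num_edges J + 2 * k \<le> k * num_verts J + 1"
    if J: "subgraph J (delete_edges G F)" and three: "3 \<le> num_verts J" for J
  proof -
    define S EJ where "S = verts J" and "EJ = edges J"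
    have finS: "finite S" and EJ: "\<And>e. e \<in> EJ \<Longrightarrow> e \<subseteq> S \<and> card e = 2"
      and EJ_sub: "EJ \<subseteq> E - edges F" and S_V: "S \<subseteq> V"
      using J by (auto simp: subgraph_def graph_def delete_edges_def S_def EJ_def V_def E_def)
    have finEJ: "finite EJ"
      using EJ_sub finE finite_subset by auto
    show ?thesis
    proof (cases "2 * k \<le> card S")
      case False
      \<comment> \<open>For small \<open>S\<close> the complete graph is sparse enough:
        \<open>card S < 2 * k\<close> means \<open>s + 3 \<le> 2 * k\<close>.\<close>
      obtain s where s: "card S = s + 2"
        using three that[of "card S - 2"] by (simp add: S_def)
      have "2 * card EJ \<le> card S * (card S - 1)"
        using finS EJ by (rule card_2_subsets_le)
      also have "\<dots> = s * (s + 3) + 2"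
        by (simp add: s algebra_simps)
      also have "\<dots> \<le> s * (2 * k) + 2"
        using False s by simp
      finally have "card EJ \<le> s * k + 1"
        by simp
      then show ?thesis
        using s by (simp add: S_def EJ_def algebra_simps)
    next
      case True
      \<comment> \<open>Edges of \<open>J\<close> are counted by their tails, which all lie in
        \<open>S\<close>.\<close>
      define out where "out v = {e \<in> EJ. t e = v}" for v
      have "EJ = (\<Union>v\<in>S. out v)"
        using t EJ EJ_sub by (auto simp: out_def)
      moreover have "card (\<Union>v\<in>S. out v) = (\<Sum>v\<in>S. card (out v))"
        using finS finEJ by (intro card_UN_disjoint) (auto simp: out_def)
      ultimately have card_EJ: "card EJ = (\<Sum>v\<in>S. card (out v))"
        by simp
      have "(\<Sum>v\<in>S. card (out v)) + 2 * k \<le> k * card S + 1"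
      proof (rule rooted_outdegree_sum_le[where R = R and N = "\<lambda>v. {w. (v, w) \<in> D}"])
        show "card (out v) \<le> k" for v
        proof -
          have "card (out v) \<le> card {e \<in> E. t e = v}"
            using EJ_sub finE by (intro card_mono) (auto simp: out_def)
          then show ?thesis using out_le le_trans by blast
        qed
        show "card (out v) < k" if v: "v \<in> S - R" for v
        proof -
          \<comment> \<open>The deleted edge \<open>{v, p v}\<close> has tail \<open>v\<close>,
            which makes the bound strict.\<close>
          have pv: "(v, p v) \<in> D" "{v, p v} \<in> edges F"
            using p v S_V by (auto simp: F_def)
          then have "out v \<subset> {e \<in> E. t e = v}"
            using EJ_sub by (auto simp: out_def D_def)
          then have "card (out v) < card {e \<in> E. t e = v}"
            using finE by (intro psubset_card_mono) auto
          then show ?thesis using out_le less_le_trans by blast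
        qed
        show "card (out r) \<le> card ({w. (r, w) \<in> D} \<inter> S)" for r
        proof -
          have "out r \<subseteq> (\<lambda>w. {r, w}) ` ({w. (r, w) \<in> D} \<inter> S)"
          proof
            fix e assume e: "e \<in> out r"
            then have "card e = 2" "e \<subseteq> S" "e \<in> E" "t e = r" "r \<in> e"
              using EJ EJ_sub t by (auto simp: out_def)
            moreover from this obtain w where "e = {r, w}"
              by (metis card_2_iff insertE insert_commute singletonD)
            ultimately show "e \<in> (\<lambda>w. {r, w}) ` ({w. (r, w) \<in> D} \<inter> S)"
              by (auto simp: D_def)
          qed
          then show ?thesis
            using finS by (meson finite_Int surj_card_le)
        qed
        \<comment> \<open>No second root reaches an out-neighbour \<open>w\<close> of a root. The
          path from \<open>r'\<close> to \<open>w\<close> is used with length 0, for a root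
          \<open>w\<close>, and with length 1, for a common out-neighbour.\<close>
        have sep1: "r = r'" if "r \<in> R" "r' \<in> R" "(r, w) \<in> D" "(r', w) \<in> D\<^sup>*" for r r' w
          using sep that D_V by (meson mem_Sigma_iff r_into_rtrancl subsetD)
        show "{w. (r, w) \<in> D} \<inter> R = {}" if "r \<in> R" for r
        proof -
          have "(r, r) \<notin> D"
            using E by (force simp: D_def)
          then show ?thesis
            using sep1[OF that] by auto
        qed
        show "{w. (r, w) \<in> D} \<inter> {w. (r', w) \<in> D} = {}" if "r \<in> R" "r' \<in> R" "r \<noteq> r'" for r r'
          using sep1 that by blast
      qed (use finS True k in auto)
      then show ?thesis
        using card_EJ by (simp add: S_def EJ_def)
    qed
  qed
  ultimately show thesis
    using that by blast
qed

section \<open>Translating densities into edge counts, and conclusion\<close>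

lemma finite_subgraphs:
  assumes "graph G"
  shows "finite {J. subgraph J G}"
proof -
  have "finite (verts G)" "finite (edges G)"
    using assms by (auto simp: graph_def intro: finite_subset[of _ "Pow (verts G)"])
  moreover have "{J. subgraph J G}
      \<subseteq> (\<lambda>(S, A). \<lparr>verts = S, edges = A\<rparr>) ` (Pow (verts G) \<times> Pow (edges G))"
  proof
    fix J assume "J \<in> {J. subgraph J G}"
    then show "J \<in> (\<lambda>(S, A). \<lparr>verts = S, edges = A\<rparr>) ` (Pow (verts G) \<times> Pow (edges G))"
      by (intro image_eqI[of _ _ "(verts J, edges J)"]) (auto simp: subgraph_def)
  qed
  ultimately show ?thesis
    by (meson finite_Pow_iff finite_SigmaI finite_imageI finite_subset)
qed

lemma density_le_max_density:
  assumes "graph G" "subgraph J G" "1 \<le> num_verts J"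
  shows "real (num_edges J) / real (num_verts J) \<le> max_density G"
proof -
  have "verts G \<noteq> {}"
    using assms by (auto simp: subgraph_def)
  then show ?thesis
    using assms finite_subgraphs[OF assms(1)] by (auto simp: max_density_def intro!: Max_ge)
qed

lemma max_density_nonneg:
  assumes "graph G"
  shows "0 \<le> max_density G"
proof (cases "verts G = {}")
  case False
  have "subgraph G G" "1 \<le> num_verts G"
    using assms False by (auto simp: subgraph_def graph_def Suc_le_eq card_gt_0_iff)
  then show ?thesis
    using density_le_max_density[OF assms] by (meson divide_nonneg_nonneg of_nat_0_le_iff order_trans)
qed (simp add: max_density_def)

text \<open>This turns the density bound into the hypothesis of the orientation lemma, by way of the
  subgraph with edges \<open>A\<close> and only the vertices that they cover.\<close>

lemma card_edges_le_max_density: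
  assumes "graph G" "A \<subseteq> edges G"
  shows "real (card A) \<le> max_density G * real (card (\<Union>A))"
proof (cases "A = {}")
  case False
  define J where "J = \<lparr>verts = \<Union>A, edges = A\<rparr>"
  have J: "subgraph J G"
    using assms by (auto simp: subgraph_def graph_def J_def intro: finite_subset)
  moreover have "\<Union>A \<noteq> {}"
    using False assms by (force simp: graph_def)
  ultimately have pos: "1 \<le> num_verts J"
    by (auto simp: subgraph_def graph_def J_def Suc_le_eq card_gt_0_iff)
  show ?thesis
    using density_le_max_density[OF assms(1) J pos] pos
    by (simp add: J_def pos_divide_le_eq)
qed simp

text \<open>The second and third assumptions cover the values 0 and 1/2 that the 2-density takes by
  convention.\<close>

lemma max_2density_leI:
  assumes "graph H" and "0 \<le> x" and "edges H \<noteq> {} \<Longrightarrow> 1 / 2 \<le> x"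
    and "\<And>J. \<lbrakk>subgraph J H; 3 \<le> num_verts J\<rbrakk>
      \<Longrightarrow> real (num_edges J) - 1 \<le> x * (real (num_verts J) - 2)"
  shows "max_2density H \<le> x"
proof (cases "edges H \<noteq> {} \<and> num_verts H \<ge> 3")
  case True
  let ?M = "{(real (num_edges J) - 1) / (real (num_verts J) - 2) | J. subgraph J H \<and> num_verts J \<ge> 3}"
  have "subgraph H H"
    using assms(1) by (simp add: subgraph_def)
  then have "?M \<noteq> {}" "finite ?M"
    using True finite_subgraphs[OF assms(1)] by auto
  moreover have "y \<le> x" if "y \<in> ?M" for y
  proof -
    obtain J where J: "subgraph J H" "3 \<le> num_verts J"
      and y: "y = (real (num_edges J) - 1) / (real (num_verts J) - 2)"
      using \<open>y \<in> ?M\<close> by blast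
    then show ?thesis
      using assms(4)[OF J] by (simp add: pos_divide_le_eq)
  qed
  ultimately have "Max ?M \<le> x"
    by (intro Max.boundedI)
  then show ?thesis
    using True by (simp add: max_2density_def)
qed (use assms in \<open>auto simp: max_2density_def\<close>)

theorem theorem5p8:
  fixes k :: int and G :: "'a sgraph"
  assumes "graph G"
    and "max_density G \<le> real_of_int k"
  shows "\<exists>F. forest F \<and> subgraph F G \<and> max_2density (delete_edges G F) \<le> real_of_int k"
proof (cases "edges G = {}")
  \<comment> \<open>Here \<open>k\<close> may be 0, which the forest construction does not admit;
    the empty forest suffices.\<close>
  case True
  define F :: "'a sgraph" where "F = \<lparr>verts = {}, edges = {}\<rparr>"
  have "forest F" "subgraph F G"
    using no_cycle_in_parent_graph[of F] by (auto simp: F_def forest_def subgraph_def graph_def)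
  moreover have "max_2density (delete_edges G F) \<le> real_of_int k"
    using True max_density_nonneg[OF assms(1)] assms(2)
    by (simp add: max_2density_def delete_edges_def)
  ultimately show ?thesis by blast
next
  case False
  define K where "K = nat k"
  have "finite (edges G)"
    using assms(1) by (auto simp: graph_def intro: finite_subset[of _ "Pow (verts G)"])
  \<comment> \<open>An edge makes the density positive, so the integer \<open>k\<close> is at least
    1.\<close>
  then have "0 < real (num_edges G)"
    using False by (simp add: card_gt_0_iff)
  also have "\<dots> \<le> max_density G * real (card (\<Union>(edges G)))"
    using assms(1) by (rule card_edges_le_max_density) simp
  finally have "0 < max_density G"
    by (simp add: zero_less_mult_iff)
  with assms(2) have k: "1 \<le> k" by linarith
  then have K: "real K = real_of_int k" "1 \<le> K"
    by (auto simp: K_def)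
  have "card A \<le> K * card (\<Union>A)" if "A \<subseteq> edges G" for A
  proof -
    have "real (card A) \<le> real K * real (card (\<Union>A))"
      using card_edges_le_max_density[OF assms(1) that] assms(2) K(1)
      by (metis mult_right_mono of_nat_0_le_iff order_trans)
    then show ?thesis
      by (metis of_nat_le_iff of_nat_mult)
  qed
  then obtain F where F: "forest F" "subgraph F G"
    and sparse: "\<And>J. \<lbrakk>subgraph J (delete_edges G F); 3 \<le> num_verts J\<rbrakk>
       \<Longrightarrow> num_edges J + 2 * K \<le> K * num_verts J + 1"
    using ex_forest_sparse_remainder[OF assms(1) K(2)] by blast
  have "max_2density (delete_edges G F) \<le> real K"
  proof (rule max_2density_leI)
    show "graph (delete_edges G F)"
      using assms(1) by (auto simp: graph_def delete_edges_def)
  next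
    fix J assume "subgraph J (delete_edges G F)" "3 \<le> num_verts J"
    then have "real (num_edges J + 2 * K) \<le> real (K * num_verts J + 1)"
      using sparse by (simp only: of_nat_le_iff)
    then show "real (num_edges J) - 1 \<le> real K * (real (num_verts J) - 2)"
      by (simp add: algebra_simps)
  qed (use K in auto)
  with F K show ?thesis by auto
qed

end
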